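(* Let $m,n$ be positive integers, let $\mathcal A,\mathcal E\in\mathbb R^{m\times n\times m\times n}$ be fourth order partially symmetric tensors, set $\widetilde{\mathcal A}=\mathcal A+\mathcal E$, and let $\alpha,\beta>0$. Then $$\lambda_{\max}^{M}(\mathcal A)+8\alpha^2\beta^2\,\lambda_{\min}^{B}(\mathcal B_{\mathcal E})\le\lambda_{\max}^{M}(\widetilde{\mathcal A})\le\lambda_{\max}^{M}(\mathcal A)+8\alpha^2\beta^2\,\lambda_{\max}^{B}(\mathcal B_{\mathcal E}),$$ where $\lambda_{\min}^{B}(\mathcal B_{\mathcal E})$ and $\lambda_{\max}^{B}(\mathcal B_{\mathcal E})$ are the smallest and largest recoverable real $\mathbf B_{\alpha,\beta}$-eigenvalues of the symmetric lifted tensor $\bar{\mathcal B}_{\mathcal E}$ of $\mathcal E$.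
   Context: Notation: $[m]=\{1,\dots,m\}$, $m+[n]=\{m+1,\dots,m+n\}$; $\mathbb R^{[4,N]}$ is the space of real fourth order tensors of size $N\times N\times N\times N$. A tensor $\mathcal A=(a_{ijkl})\in\mathbb R^{m\times n\times m\times n}$ is partially symmetric if $a_{ijkl}=a_{kjil}=a_{ilkj}=a_{klij}$ for all $i,k\in[m]$, $j,l\in[n]$. Put $\mathcal A\mathbf x\mathbf y\mathbf x\mathbf y=\sum_{i,k\in[m];\,j,l\in[n]}a_{ijkl}x_iy_jx_ky_l$ for $\mathbf x\in\mathbb R^m$, $\mathbf y\in\mathbb R^n$, and let the largest $M$-eigenvalue be $$\lambda_{\max}^{M}(\mathcal A):=\max_{\mathbf x^\top\mathbf x=1,\ \mathbf y^\top\mathbf y=1}\mathcal A\mathbf x\mathbf y\mathbf x\mathbf y.$$ For partially symmetric $\mathcal A$, the lifted tensor $\mathcal B_{\mathcal A}=(b_{t_1t_2t_3t_4})\in\mathbb R^{[4,m+n]}$ is $$b_{t_1t_2t_3t_4}=\begin{cases}a_{t_1,\,t_2-m,\,t_3,\,t_4-m},&t_1,t_3\in[m],\ t_2,t_4\in m+[n],\\ a_{t_2,\,t_3-m,\,t_4,\,t_1-m},&t_1,t_3\in m+[n],\ t_2,t_4\in[m],\\0,&\text{otherwise,}\end{cases}$$ and the symmetric lifted tensor $\bar{\mathcal B}_{\mathcal A}=(\bar b_{t_1t_2t_3t_4})$ is $$\bar b_{t_1t_2t_3t_4}=\tfrac16\left(b_{t_1t_2t_3t_4}+b_{t_1t_3t_2t_4}+b_{t_1t_2t_4t_3}+b_{t_2t_1t_3t_4}+b_{t_2t_1t_4t_3}+b_{t_3t_1t_4t_2}\right).$$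 Let $\mathbf B_{\alpha,\beta}=\operatorname{diag}(2\beta^2\mathbf I_m,2\alpha^2\mathbf I_n)$. A pair $(\lambda,\mathbf w)\in\mathbb R\times(\mathbb R^{m+n}\setminus\{\mathbf 0\})$ is a $\mathbf B_{\alpha,\beta}$-eigenpair of a symmetric $\mathcal T=(\tau_{t_1t_2t_3t_4})\in\mathbb R^{[4,m+n]}$ if $\mathcal T\mathbf w^3=\lambda\mathbf B_{\alpha,\beta}\mathbf w$ and $\mathbf w^\top\mathbf B_{\alpha,\beta}\mathbf w=1$, where $(\mathcal T\mathbf w^3)_{t_1}=\sum_{t_2,t_3,t_4}\tau_{t_1t_2t_3t_4}w_{t_2}w_{t_3}w_{t_4}$. A real $\mathbf B_{\alpha,\beta}$-eigenvalue $\lambda$ of $\bar{\mathcal B}_{\mathcal E}$ is recoverable if it has a $\mathbf B_{\alpha,\beta}$-eigenpair $(\lambda,\mathbf w)$, $\mathbf w=(\mathbf w_x^\top,\mathbf w_y^\top)^\top$ with $\mathbf w_x\in\mathbb R^m$, $\mathbf w_y\in\mathbb R^n$, such that either $\lambda\neq0$, or $\lambda=0$ with $\mathbf w_x\neq\mathbf 0$ and $\mathbf w_y\neq\mathbf 0$ (i.e. the eigenpair yields an $M$-eigenpair of $\mathcal E$ by rescaling the two blocks). *)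

theory Defs
  imports "HOL-Analysis.Analysis"
begin

text \<open>
  The dimensions \<open>m, n \<ge> 1\<close> are the cardinalities of arbitrary finite index types
  \<open>'m\<close> and \<open>'n\<close>. A tensor in \<open>R^(m x n x m x n)\<close> has type \<^typ>\<open>real^'n^'m^'n^'m\<close>, with
  entries \<open>A $ i $ j $ k $ l\<close> where \<open>i, k :: 'm\<close> and \<open>j, l :: 'n\<close>.
  The index set \<open>[m + n]\<close> is the sum type \<^typ>\<open>'m + 'n\<close>: \<open>Inl\<close> embeds \<open>[m]\<close>, and \<open>Inr\<close> is
  the shift of \<open>[n]\<close> onto \<open>m + [n]\<close>.
\<close>

definition partially_symmetric :: "real^'n^'m^'n^'m \<Rightarrow> bool" where
  "partially_symmetric A \<longleftrightarrow> (\<forall>i j k l.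
     A $ i $ j $ k $ l = A $ k $ j $ i $ l \<and>
     A $ i $ j $ k $ l = A $ i $ l $ k $ j \<and>
     A $ i $ j $ k $ l = A $ k $ l $ i $ j)"

definition biquadratic_form :: "real^'n^'m^'n^'m \<Rightarrow> real^'m \<Rightarrow> real^'n \<Rightarrow> real" where
  "biquadratic_form A x y =
     (\<Sum>i\<in>UNIV. \<Sum>j\<in>UNIV. \<Sum>k\<in>UNIV. \<Sum>l\<in>UNIV.
        A $ i $ j $ k $ l * x $ i * y $ j * x $ k * y $ l)"

text \<open>\<open>GREATEST\<close> and \<open>LEAST\<close> denote an attained maximum and minimum, not a
  supremum or infimum.\<close>

definition lambda_max_M :: "real^'n^'m^'n^'m \<Rightarrow> real" where
  "lambda_max_M A =
     (GREATEST r. \<exists>x y. x \<bullet> x = 1 \<and> y \<bullet> y = 1 \<and> r = biquadratic_form A x y)"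

text \<open>The second branch is the entry of \<open>A\<close> at \<open>(t2, t3 - m, t4, t1 - m)\<close>.\<close>

definition lifted_tensor ::
  "real^'n^'m^'n^'m \<Rightarrow> real^('m + 'n)^('m + 'n)^('m + 'n)^('m + 'n)" where
  "lifted_tensor A = (\<chi> t1 t2 t3 t4.
     (case (t1, t2, t3, t4) of
        (Inl i, Inr j, Inl k, Inr l) \<Rightarrow> A $ i $ j $ k $ l
      | (Inr l, Inl i, Inr j, Inl k) \<Rightarrow> A $ i $ j $ k $ l
      | _ \<Rightarrow> 0))"

definition sym_lifted_tensor ::
  "real^'n^'m^'n^'m \<Rightarrow> real^('m + 'n)^('m + 'n)^('m + 'n)^('m + 'n)" where
  "sym_lifted_tensor A = (let b = lifted_tensor A in
     (\<chi> t1 t2 t3 t4. (1 / 6) *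
       (b $ t1 $ t2 $ t3 $ t4 + b $ t1 $ t3 $ t2 $ t4 + b $ t1 $ t2 $ t4 $ t3 +
        b $ t2 $ t1 $ t3 $ t4 + b $ t2 $ t1 $ t4 $ t3 + b $ t3 $ t1 $ t4 $ t2)))"

definition B_matrix :: "real \<Rightarrow> real \<Rightarrow> real^('m::finite + 'n::finite)^('m + 'n)" where
  "B_matrix \<alpha> \<beta> = (\<chi> s t.
     if s = t then (case s of Inl _ \<Rightarrow> 2 * \<beta>\<^sup>2 | Inr _ \<Rightarrow> 2 * \<alpha>\<^sup>2) else 0)"

definition tensor_cube :: "real^'d^'d^'d^'d \<Rightarrow> real^'d \<Rightarrow> real^'d" where
  "tensor_cube T w = (\<chi> t1. \<Sum>t2\<in>UNIV. \<Sum>t3\<in>UNIV. \<Sum>t4\<in>UNIV.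
     T $ t1 $ t2 $ t3 $ t4 * w $ t2 * w $ t3 * w $ t4)"

definition B_eigenpair ::
  "real^'d^'d \<Rightarrow> real^'d^'d^'d^'d \<Rightarrow> real \<Rightarrow> real^'d \<Rightarrow> bool" where
  "B_eigenpair B T \<mu> w \<longleftrightarrow>
     w \<noteq> 0 \<and> tensor_cube T w = \<mu> *\<^sub>R (B *v w) \<and> w \<bullet> (B *v w) = 1"

definition x_block :: "real^('m::finite + 'n::finite) \<Rightarrow> real^'m" where
  "x_block w = (\<chi> i. w $ Inl i)"

definition y_block :: "real^('m::finite + 'n::finite) \<Rightarrow> real^'n" where
  "y_block w = (\<chi> j. w $ Inr j)"

definition recoverable_B_eigenvalue ::
  "real \<Rightarrow> real \<Rightarrow> real^'n^'m^'n^'m \<Rightarrow> real \<Rightarrow> bool" where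
  "recoverable_B_eigenvalue \<alpha> \<beta> E \<mu> \<longleftrightarrow>
     (\<exists>w. B_eigenpair (B_matrix \<alpha> \<beta>) (sym_lifted_tensor E) \<mu> w \<and>
          (\<mu> \<noteq> 0 \<or> \<mu> = 0 \<and> x_block w \<noteq> 0 \<and> y_block w \<noteq> 0))"

definition lambda_max_B :: "real \<Rightarrow> real \<Rightarrow> real^'n^'m^'n^'m \<Rightarrow> real" where
  "lambda_max_B \<alpha> \<beta> E = (GREATEST \<mu>. recoverable_B_eigenvalue \<alpha> \<beta> E \<mu>)"

definition lambda_min_B :: "real \<Rightarrow> real \<Rightarrow> real^'n^'m^'n^'m \<Rightarrow> real" where
  "lambda_min_B \<alpha> \<beta> E = (LEAST \<mu>. recoverable_B_eigenvalue \<alpha> \<beta> E \<mu>)"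

end

theory Submission
  imports Defs
begin

text \<open>
  For \<open>w = (x, y)\<close> the two blocks of \<open>tensor_cube (sym_lifted_tensor E) w\<close> are half the partial
  gradients of \<open>biquadratic_form E x y\<close>. Pairing the eigenvalue equations with \<open>x\<close> and \<open>y\<close> shows
  that for \<open>\<mu> \<noteq> 0\<close> both weighted block norms are equal, so \<open>(2\<beta>x, 2\<alpha>y)\<close> is a pair of
  unit vectors at which the form of \<open>E\<close> takes the value \<open>8\<alpha>\<^sup>2\<beta>\<^sup>2\<mu>\<close>. Conversely, an extremal
  pair of unit vectors satisfies the Lagrange equations and rescales to an eigenpair. Hence the
  extreme recoverable eigenvalues are the extreme values of the form divided by
  \<open>8\<alpha>\<^sup>2\<beta>\<^sup>2\<close>, and the bounds follow as in Weyl's inequality.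
\<close>

section \<open>Sums over a sum type, and maximizers of quadratic forms\<close>

lemma sum_UNIV_Plus:
  fixes f :: "'a::finite + 'b::finite \<Rightarrow> 'c::comm_monoid_add"
  shows "(\<Sum>t\<in>UNIV. f t) = (\<Sum>i\<in>UNIV. f (Inl i)) + (\<Sum>j\<in>UNIV. f (Inr j))"
proof -
  have "(\<Sum>t\<in>UNIV. f t) = sum f (UNIV <+> UNIV)"
    by simp
  also have "\<dots> = (\<Sum>i\<in>UNIV. f (Inl i)) + (\<Sum>j\<in>UNIV. f (Inr j))"
    by (simp add: sum.Plus comp_def del: UNIV_Plus_UNIV)
  finally show ?thesis .
qed

text \<open>A polynomial without constant term that is nowhere negative has a minimum at 0, so its
  derivative \<open>b\<close> there vanishes.\<close>

lemma linear_coeff_eq_0: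
  fixes b c :: real
  assumes "\<And>t. 0 \<le> b * t + c * t\<^sup>2"
  shows "b = 0"
proof (rule ccontr)
  assume "b \<noteq> 0"
  \<comment> \<open>Any positive \<open>d\<close> above \<open>c\<close> would do: at
    \<open>t = - b / d\<close> the negative linear term then outweighs the quadratic one.\<close>
  define d where "d = \<bar>c\<bar> + 1"
  have d: "d > 0" "c < d"
    unfolding d_def by auto
  have "0 \<le> b * (- b / d) + c * (- b / d)\<^sup>2"
    by (rule assms)
  also have "\<dots> = b\<^sup>2 * (c - d) / d\<^sup>2"
    using d by (simp add: field_simps power2_eq_square)
  also have "\<dots> < 0"
    using d \<open>b \<noteq> 0\<close> by (intro divide_neg_pos mult_pos_neg) auto
  finally show False
    by simp
qed

text \<open>By \<open>le\<close> and \<open>eq\<close>, the function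
  \<open>c * (x \<bullet> x) - x \<bullet> (S *v x)\<close> has its minimum 0 at \<open>u\<close>,
  so its gradient vanishes there. For symmetric \<open>S\<close> this gradient is twice
  \<open>c *\<^sub>R u - S *v u\<close>.\<close>

lemma symmetric_matrix_maximizer_eigenvector:
  fixes S :: "real^'d^'d"
  assumes sym: "transpose S = S"
    and le: "\<And>x. x \<bullet> (S *v x) \<le> c * (x \<bullet> x)"
    and eq: "u \<bullet> (S *v u) = c * (u \<bullet> u)"
  shows "S *v u = c *\<^sub>R u"
proof -
  \<comment> \<open>Half the gradient serves as the direction of perturbation: along
    \<open>u + t *\<^sub>R r\<close> the coefficient of \<open>t\<close> is then
    \<open>2 * (r \<bullet> r)\<close>.\<close>
  define r where "r = c *\<^sub>R u - S *v u"
  have swap: "u \<bullet> (S *v r) = r \<bullet> (S *v u)"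
    by (metis sym dot_lmul_matrix inner_commute transpose_matrix_vector)
  have "0 \<le> 2 * (r \<bullet> r) * t + (c * (r \<bullet> r) - r \<bullet> (S *v r)) * t\<^sup>2" for t
  proof -
    have "0 \<le> c * ((u + t *\<^sub>R r) \<bullet> (u + t *\<^sub>R r)) - (u + t *\<^sub>R r) \<bullet> (S *v (u + t *\<^sub>R r))"
      using le[of "u + t *\<^sub>R r"] by simp
    also have "\<dots> = 2 * t * (c * (r \<bullet> u) - r \<bullet> (S *v u))
        + (c * (r \<bullet> r) - r \<bullet> (S *v r)) * t\<^sup>2"
      using eq swap
      by (simp add: matrix_vector_right_distrib matrix_vector_mult_scaleR inner_add_left
          inner_add_right inner_commute[of u r] algebra_simps power2_eq_square)
    also have "c * (r \<bullet> u) - r \<bullet> (S *v u) = r \<bullet> r"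
      by (simp add: r_def inner_diff_right)
    finally show ?thesis
      by (simp add: algebra_simps)
  qed
  then have "2 * (r \<bullet> r) = 0"
    by (rule linear_coeff_eq_0)
  then show ?thesis
    by (simp add: r_def)
qed

section \<open>The quadratic forms that arise by fixing one argument\<close>

text \<open>With \<open>y\<close> fixed, the biquadratic form is a quadratic form in
  \<open>x\<close> with this coefficient matrix; \<open>y_matrix\<close> is the counterpart for
  fixed \<open>x\<close>. Facts on eigenvectors of symmetric matrices thus apply to each argument
  separately.\<close>

definition x_matrix :: "real^'n^'m^'n^'m \<Rightarrow> real^'n \<Rightarrow> real^'m^'m" where
  "x_matrix E y = (\<chi> i k. \<Sum>j\<in>UNIV. \<Sum>l\<in>UNIV. E $ i $ j $ k $ l * y $ j * y $ l)"

definition y_matrix :: "real^'n^'m^'n^'m \<Rightarrow> real^'m \<Rightarrow> real^'n^'n" where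
  "y_matrix E x = (\<chi> j l. \<Sum>i\<in>UNIV. \<Sum>k\<in>UNIV. E $ i $ j $ k $ l * x $ i * x $ k)"

lemma partially_symmetricD:
  assumes "partially_symmetric E"
  shows "E $ k $ j $ i $ l = E $ i $ j $ k $ l"
    and "E $ i $ l $ k $ j = E $ i $ j $ k $ l"
    and "E $ k $ l $ i $ j = E $ i $ j $ k $ l"
  using assms unfolding partially_symmetric_def by blast+

lemma partially_symmetric_uminus:
  assumes "partially_symmetric E" shows "partially_symmetric (- E)"
  unfolding partially_symmetric_def
  by (intro allI conjI) (simp_all only: vector_uminus_component, (intro arg_cong[of _ _ uminus] partially_symmetricD[OF assms])+)

lemma transpose_x_matrix:
  "partially_symmetric E \<Longrightarrow> transpose (x_matrix E y) = x_matrix E y"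
  by (simp add: x_matrix_def transpose_def vec_eq_iff partially_symmetricD(1) mult_ac)

lemma transpose_y_matrix:
  "partially_symmetric E \<Longrightarrow> transpose (y_matrix E x) = y_matrix E x"
  by (simp add: y_matrix_def transpose_def vec_eq_iff partially_symmetricD(2) mult_ac)

lemma biquadratic_form_x_matrix:
  "biquadratic_form E x y = x \<bullet> (x_matrix E y *v x)"
proof -
  have "biquadratic_form E x y = (\<Sum>i\<in>UNIV. \<Sum>k\<in>UNIV. \<Sum>j\<in>UNIV. \<Sum>l\<in>UNIV.
      E $ i $ j $ k $ l * x $ i * y $ j * x $ k * y $ l)"
    unfolding biquadratic_form_def by (intro sum.cong refl sum.swap)
  then show ?thesis
    by (simp add: x_matrix_def inner_vec_def matrix_vector_mult_def sum_distrib_left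
        sum_distrib_right mult_ac)
qed

lemma biquadratic_form_y_matrix:
  "biquadratic_form E x y = y \<bullet> (y_matrix E x *v y)"
proof -
  have "biquadratic_form E x y = (\<Sum>j\<in>UNIV. \<Sum>i\<in>UNIV. \<Sum>l\<in>UNIV. \<Sum>k\<in>UNIV.
      E $ i $ j $ k $ l * x $ i * y $ j * x $ k * y $ l)"
    unfolding biquadratic_form_def by (subst sum.swap) (intro sum.cong refl sum.swap)
  also have "\<dots> = (\<Sum>j\<in>UNIV. \<Sum>l\<in>UNIV. \<Sum>i\<in>UNIV. \<Sum>k\<in>UNIV.
      E $ i $ j $ k $ l * x $ i * y $ j * x $ k * y $ l)"
    by (intro sum.cong refl sum.swap)
  finally show ?thesis
    by (simp add: y_matrix_def inner_vec_def matrix_vector_mult_def sum_distrib_left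
        sum_distrib_right mult_ac)
qed

lemma biquadratic_form_add:
  "biquadratic_form (A + E) x y = biquadratic_form A x y + biquadratic_form E x y"
  unfolding biquadratic_form_def by (simp add: sum.distrib distrib_right)

lemma uminus_matrix_vector_mult: "(- S) *v x = - (S *v x)"
  for S :: "real^'a^'b"
  by (simp add: matrix_vector_mult_def vec_eq_iff sum_negf)

lemma x_matrix_scaleR: "x_matrix E (b *\<^sub>R y) = b\<^sup>2 *\<^sub>R x_matrix E y"
  by (simp add: x_matrix_def vec_eq_iff sum_distrib_left power2_eq_square mult_ac)

lemma y_matrix_scaleR: "y_matrix E (a *\<^sub>R x) = a\<^sup>2 *\<^sub>R y_matrix E x"
  by (simp add: y_matrix_def vec_eq_iff sum_distrib_left power2_eq_square mult_ac)

lemma x_matrix_uminus: "x_matrix (- E) y = - x_matrix E y"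
  by (simp add: x_matrix_def vec_eq_iff sum_negf)

lemma y_matrix_uminus: "y_matrix (- E) x = - y_matrix E x"
  by (simp add: y_matrix_def vec_eq_iff sum_negf)

lemma biquadratic_form_scaleR:
  "biquadratic_form E (a *\<^sub>R x) (b *\<^sub>R y) = a\<^sup>2 * b\<^sup>2 * biquadratic_form E x y"
  by (simp add: biquadratic_form_x_matrix x_matrix_scaleR matrix_vector_mult_scaleR
      scaleR_matrix_vector_assoc[symmetric] power2_eq_square)

section \<open>Maximizing pairs of unit vectors\<close>

text \<open>A continuous function attains its maximum on the compact product of two unit spheres.
  This gives the \<open>GREATEST\<close> in \<open>lambda_max_M\<close> a value to denote.\<close>

lemma biquadratic_form_maximizer:
  fixes E :: "real^'n^'m^'n^'m"
  obtains u v where "u \<bullet> u = 1" "v \<bullet> v = 1" "lambda_max_M E = biquadratic_form E u v"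
    "\<And>x y. x \<bullet> x = 1 \<Longrightarrow> y \<bullet> y = 1 \<Longrightarrow> biquadratic_form E x y \<le> biquadratic_form E u v"
proof -
  let ?S = "sphere (0 :: real^'m) 1 \<times> sphere (0 :: real^'n) 1"
  let ?f = "\<lambda>p. biquadratic_form E (fst p) (snd p)"
  have "compact ?S"
    by (intro compact_Times compact_sphere)
  moreover have "?S \<noteq> {}"
    by (simp add: sphere_eq_empty)
  moreover have "continuous_on ?S ?f"
    unfolding biquadratic_form_def by (intro continuous_intros)
  ultimately obtain p where p: "p \<in> ?S" and max: "\<forall>q\<in>?S. ?f q \<le> ?f p"
    using continuous_attains_sup by blast
  obtain u v where uv: "p = (u, v)"
    by (cases p)
  have 1: "u \<bullet> u = 1" "v \<bullet> v = 1"
    using p by (auto simp: uv norm_eq_1)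
  have 2: "biquadratic_form E x y \<le> biquadratic_form E u v" if "x \<bullet> x = 1" "y \<bullet> y = 1" for x y
    using max that by (auto simp: uv norm_eq_1)
  have "lambda_max_M E = biquadratic_form E u v"
    unfolding lambda_max_M_def by (rule Greatest_equality) (use 1 2 in blast)+
  with 1 2 that show ?thesis
    by blast
qed

lemma biquadratic_form_le_lambda_max_M:
  "x \<bullet> x = 1 \<Longrightarrow> y \<bullet> y = 1 \<Longrightarrow> biquadratic_form E x y \<le> lambda_max_M E"
  by (metis biquadratic_form_maximizer)

text \<open>Both sides scale with the square of \<open>norm x\<close>. This turns a bound on the
  sphere into the homogeneous bound that \<open>symmetric_matrix_maximizer_eigenvector\<close>
  takes.\<close>

lemma quadratic_form_le_of_unit:
  fixes S :: "real^'d^'d"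
  assumes "\<And>x. x \<bullet> x = 1 \<Longrightarrow> x \<bullet> (S *v x) \<le> c"
  shows "x \<bullet> (S *v x) \<le> c * (x \<bullet> x)"
proof (cases "x = 0")
  case False
  define z where "z = (1 / norm x) *\<^sub>R x"
  have x: "x = norm x *\<^sub>R z"
    using False by (simp add: z_def)
  have "z \<bullet> z = 1"
    using False by (simp add: z_def dot_square_norm power2_eq_square)
  then have "(norm x)\<^sup>2 * (z \<bullet> (S *v z)) \<le> (norm x)\<^sup>2 * c"
    by (intro mult_left_mono assms) auto
  moreover have "x \<bullet> (S *v x) = (norm x)\<^sup>2 * (z \<bullet> (S *v z))"
    by (subst (1 2) x) (simp add: matrix_vector_mult_scaleR power2_eq_square)
  ultimately show ?thesis
    by (simp add: dot_square_norm mult.commute)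
qed simp

text \<open>With one vector of a maximizing pair held fixed, the other maximizes a quadratic form on
  the unit sphere and is therefore an eigenvector. Both eigenvalues are the same maximal value,
  since both quadratic forms evaluate to it.\<close>

lemma maximizer_M_eigenpair:
  assumes E: "partially_symmetric E"
    and uv: "u \<bullet> u = 1" "v \<bullet> v = 1"
    and max: "\<And>x y. x \<bullet> x = 1 \<Longrightarrow> y \<bullet> y = 1 \<Longrightarrow> biquadratic_form E x y \<le> biquadratic_form E u v"
  shows "x_matrix E v *v u = biquadratic_form E u v *\<^sub>R u"
    and "y_matrix E u *v v = biquadratic_form E u v *\<^sub>R v"
proof -
  show "x_matrix E v *v u = biquadratic_form E u v *\<^sub>R u"
  proof (rule symmetric_matrix_maximizer_eigenvector)
    show "x \<bullet> (x_matrix E v *v x) \<le> biquadratic_form E u v * (x \<bullet> x)" for x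
      by (rule quadratic_form_le_of_unit)
         (use max[OF _ uv(2)] in \<open>simp add: biquadratic_form_x_matrix\<close>)
  qed (use E uv in \<open>auto simp: transpose_x_matrix biquadratic_form_x_matrix\<close>)
  show "y_matrix E u *v v = biquadratic_form E u v *\<^sub>R v"
  proof (rule symmetric_matrix_maximizer_eigenvector)
    show "y \<bullet> (y_matrix E u *v y) \<le> biquadratic_form E u v * (y \<bullet> y)" for y
      by (rule quadratic_form_le_of_unit)
         (use max[OF uv(1)] in \<open>simp add: biquadratic_form_y_matrix\<close>)
  qed (use E uv in \<open>auto simp: transpose_y_matrix biquadratic_form_y_matrix\<close>)
qed

section \<open>Block form of the symmetric lifted tensor and its eigenpairs\<close>

lemma lifted_tensor_nth:
  "lifted_tensor E $ t1 $ t2 $ t3 $ t4 =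
     (case (t1, t2, t3, t4) of
        (Inl i, Inr j, Inl k, Inr l) \<Rightarrow> E $ i $ j $ k $ l
      | (Inr l, Inl i, Inr j, Inl k) \<Rightarrow> E $ i $ j $ k $ l
      | _ \<Rightarrow> 0)"
  by (simp add: lifted_tensor_def)

text \<open>Each of the six index patterns with two indices in either block receives exactly two of the
  six summands, so the symmetrization divides the entries of \<open>E\<close> by 3.\<close>

lemma sym_lifted_tensor_nth:
  assumes "partially_symmetric E"
  shows "sym_lifted_tensor E $ t1 $ t2 $ t3 $ t4 =
     (case (t1, t2, t3, t4) of
        (Inl i, Inr j, Inl k, Inr l) \<Rightarrow> E $ i $ j $ k $ l / 3
      | (Inl i, Inr j, Inr l, Inl k) \<Rightarrow> E $ i $ j $ k $ l / 3
      | (Inl i, Inl k, Inr j, Inr l) \<Rightarrow> E $ i $ j $ k $ l / 3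
      | (Inr j, Inl i, Inr l, Inl k) \<Rightarrow> E $ i $ j $ k $ l / 3
      | (Inr j, Inl i, Inl k, Inr l) \<Rightarrow> E $ i $ j $ k $ l / 3
      | (Inr j, Inr l, Inl i, Inl k) \<Rightarrow> E $ i $ j $ k $ l / 3
      | _ \<Rightarrow> 0)"
  by (cases t1; cases t2; cases t3; cases t4)
     (simp_all add: sym_lifted_tensor_def Let_def lifted_tensor_nth partially_symmetricD[OF assms])

text \<open>Once the first index is \<open>Inl i\<close>, a nonzero entry has exactly one further
  \<open>Inl\<close> index. Its three possible positions yield three equal sums, which cancel the
  factor 1/3 of the entries.\<close>

lemma x_block_tensor_cube:
  assumes "partially_symmetric E"
  shows "x_block (tensor_cube (sym_lifted_tensor E) w) = x_matrix E (y_block w) *v x_block w"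
proof -
  have "tensor_cube (sym_lifted_tensor E) w $ Inl i = (x_matrix E (y_block w) *v x_block w) $ i" for i
  proof -
    let ?f = "\<lambda>j k l. E $ i $ j $ k $ l * w $ Inr j * w $ Inl k * w $ Inr l / 3"
    have 1: "(\<Sum>k\<in>UNIV. \<Sum>j\<in>UNIV. \<Sum>l\<in>UNIV. ?f j k l) = (\<Sum>j\<in>UNIV. \<Sum>k\<in>UNIV. \<Sum>l\<in>UNIV. ?f j k l)"
      by (rule sum.swap)
    have 2: "(\<Sum>j\<in>UNIV. \<Sum>l\<in>UNIV. \<Sum>k\<in>UNIV. ?f j k l) = (\<Sum>j\<in>UNIV. \<Sum>k\<in>UNIV. \<Sum>l\<in>UNIV. ?f j k l)"
      by (intro sum.cong refl sum.swap)
    have "tensor_cube (sym_lifted_tensor E) w $ Inl i =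
        (\<Sum>k\<in>UNIV. \<Sum>j\<in>UNIV. \<Sum>l\<in>UNIV. ?f j k l) + ((\<Sum>j\<in>UNIV. \<Sum>k\<in>UNIV. \<Sum>l\<in>UNIV. ?f j k l) +
         (\<Sum>j\<in>UNIV. \<Sum>l\<in>UNIV. \<Sum>k\<in>UNIV. ?f j k l))"
      by (simp add: tensor_cube_def sum_UNIV_Plus sym_lifted_tensor_nth[OF assms] sum.distrib mult_ac)
    also have "\<dots> = 3 * (\<Sum>k\<in>UNIV. \<Sum>j\<in>UNIV. \<Sum>l\<in>UNIV. ?f j k l)"
      unfolding 2 1 by simp
    also have "\<dots> = (x_matrix E (y_block w) *v x_block w) $ i"
      by (simp add: x_matrix_def x_block_def y_block_def matrix_vector_mult_def sum_distrib_left
          sum_distrib_right mult_ac)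
    finally show ?thesis .
  qed
  then show ?thesis
    by (simp add: vec_eq_iff x_block_def)
qed

text \<open>The same count with the blocks exchanged: after \<open>Inr j\<close> there is one
  further \<open>Inr\<close> index, again with three positions.\<close>

lemma y_block_tensor_cube:
  assumes "partially_symmetric E"
  shows "y_block (tensor_cube (sym_lifted_tensor E) w) = y_matrix E (x_block w) *v y_block w"
proof -
  have "tensor_cube (sym_lifted_tensor E) w $ Inr j = (y_matrix E (x_block w) *v y_block w) $ j" for j
  proof -
    let ?f = "\<lambda>i k l. E $ i $ j $ k $ l * w $ Inl i * w $ Inl k * w $ Inr l / 3"
    have 1: "(\<Sum>l\<in>UNIV. \<Sum>i\<in>UNIV. \<Sum>k\<in>UNIV. ?f i k l) = (\<Sum>i\<in>UNIV. \<Sum>l\<in>UNIV. \<Sum>k\<in>UNIV. ?f i k l)"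
      by (rule sum.swap)
    have 2: "(\<Sum>i\<in>UNIV. \<Sum>k\<in>UNIV. \<Sum>l\<in>UNIV. ?f i k l) = (\<Sum>i\<in>UNIV. \<Sum>l\<in>UNIV. \<Sum>k\<in>UNIV. ?f i k l)"
      by (intro sum.cong refl sum.swap)
    have "tensor_cube (sym_lifted_tensor E) w $ Inr j =
        (\<Sum>i\<in>UNIV. \<Sum>k\<in>UNIV. \<Sum>l\<in>UNIV. ?f i k l) + ((\<Sum>i\<in>UNIV. \<Sum>l\<in>UNIV. \<Sum>k\<in>UNIV. ?f i k l) +
         (\<Sum>l\<in>UNIV. \<Sum>i\<in>UNIV. \<Sum>k\<in>UNIV. ?f i k l))"
      by (simp add: tensor_cube_def sum_UNIV_Plus sym_lifted_tensor_nth[OF assms] sum.distrib mult_ac)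
    also have "\<dots> = 3 * (\<Sum>l\<in>UNIV. \<Sum>i\<in>UNIV. \<Sum>k\<in>UNIV. ?f i k l)"
      unfolding 2 1 by simp
    also have "\<dots> = (y_matrix E (x_block w) *v y_block w) $ j"
      by (simp add: y_matrix_def x_block_def y_block_def matrix_vector_mult_def sum_distrib_left
          sum_distrib_right mult_ac)
    finally show ?thesis .
  qed
  then show ?thesis
    by (simp add: vec_eq_iff y_block_def)
qed

lemma block_eq_iff: "v = w \<longleftrightarrow> x_block v = x_block w \<and> y_block v = y_block w"
  unfolding vec_eq_iff x_block_def y_block_def by (simp add: split_sum_all)

lemma block_scaleR:
  "x_block (c *\<^sub>R w) = c *\<^sub>R x_block w" "y_block (c *\<^sub>R w) = c *\<^sub>R y_block w"
  by (simp_all add: x_block_def y_block_def vec_eq_iff)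

lemma block_zero: "x_block 0 = 0" "y_block 0 = 0"
  by (simp_all add: x_block_def y_block_def vec_eq_iff)

lemma inner_block: "v \<bullet> w = x_block v \<bullet> x_block w + y_block v \<bullet> y_block w"
  by (simp add: inner_vec_def x_block_def y_block_def sum_UNIV_Plus)

lemma block_B_matrix:
  "x_block (B_matrix \<alpha> \<beta> *v w) = (2 * \<beta>\<^sup>2) *\<^sub>R x_block w"
  "y_block (B_matrix \<alpha> \<beta> *v w) = (2 * \<alpha>\<^sup>2) *\<^sub>R y_block w"
  by (simp_all add: x_block_def y_block_def vec_eq_iff matrix_vector_mult_def B_matrix_def
      sum_UNIV_Plus if_distrib[of "\<lambda>a. a * _"] cong: if_cong)

text \<open>The tensor equation splits into one matrix equation per block. On the right-hand side it
  is the normalization that keeps \<open>w\<close> from being zero.\<close>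

lemma B_eigenpair_block_iff:
  assumes "partially_symmetric E"
  shows "B_eigenpair (B_matrix \<alpha> \<beta>) (sym_lifted_tensor E) \<mu> w \<longleftrightarrow>
    x_matrix E (y_block w) *v x_block w = (\<mu> * (2 * \<beta>\<^sup>2)) *\<^sub>R x_block w \<and>
    y_matrix E (x_block w) *v y_block w = (\<mu> * (2 * \<alpha>\<^sup>2)) *\<^sub>R y_block w \<and>
    2 * \<beta>\<^sup>2 * (x_block w \<bullet> x_block w) + 2 * \<alpha>\<^sup>2 * (y_block w \<bullet> y_block w) = 1"
  unfolding B_eigenpair_def block_eq_iff[of "tensor_cube _ _"]
  by (auto simp: x_block_tensor_cube[OF assms] y_block_tensor_cube[OF assms] block_scaleR
      block_B_matrix block_zero inner_block)

section \<open>Recoverable eigenvalues as values of the biquadratic form\<close>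

text \<open>The unit vectors are rescaled blocks of an eigenvector. For \<open>\<mu> = 0\<close> the
  form vanishes at the blocks, hence at every rescaling of them, and recoverability provides nonzero
  blocks to normalize. For \<open>\<mu> \<noteq> 0\<close> each block carries half of the
  normalization, which fixes the factors \<open>2 * \<beta>\<close> and
  \<open>2 * \<alpha>\<close>.\<close>

lemma recoverable_imp_value:
  assumes E: "partially_symmetric E"
    and rec: "recoverable_B_eigenvalue \<alpha> \<beta> E \<mu>"
  obtains u v where "u \<bullet> u = 1" "v \<bullet> v = 1" "8 * \<alpha>\<^sup>2 * \<beta>\<^sup>2 * \<mu> = biquadratic_form E u v"
proof -
  obtain w where w: "B_eigenpair (B_matrix \<alpha> \<beta>) (sym_lifted_tensor E) \<mu> w"
    and cases: "\<mu> \<noteq> 0 \<or> \<mu> = 0 \<and> x_block w \<noteq> 0 \<and> y_block w \<noteq> 0"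
    using rec unfolding recoverable_B_eigenvalue_def by blast
  define x y where "x = x_block w" and "y = y_block w"
  have ex: "x_matrix E y *v x = (\<mu> * (2 * \<beta>\<^sup>2)) *\<^sub>R x"
    and ey: "y_matrix E x *v y = (\<mu> * (2 * \<alpha>\<^sup>2)) *\<^sub>R y"
    and nrm: "2 * \<beta>\<^sup>2 * (x \<bullet> x) + 2 * \<alpha>\<^sup>2 * (y \<bullet> y) = 1"
    using w unfolding B_eigenpair_block_iff[OF E] x_def y_def by auto
  have fx: "biquadratic_form E x y = \<mu> * (2 * \<beta>\<^sup>2 * (x \<bullet> x))"
    by (simp add: biquadratic_form_x_matrix ex)
  have fy: "biquadratic_form E x y = \<mu> * (2 * \<alpha>\<^sup>2 * (y \<bullet> y))"
    by (simp add: biquadratic_form_y_matrix ey)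
  show ?thesis
  proof (cases "\<mu> = 0")
    case True
    then have "x \<noteq> 0" "y \<noteq> 0"
      using cases by (auto simp: x_def y_def)
    then have "((1 / norm x) *\<^sub>R x) \<bullet> ((1 / norm x) *\<^sub>R x) = 1"
      "((1 / norm y) *\<^sub>R y) \<bullet> ((1 / norm y) *\<^sub>R y) = 1"
      by (simp_all add: dot_square_norm power2_eq_square)
    moreover have "8 * \<alpha>\<^sup>2 * \<beta>\<^sup>2 * \<mu> = biquadratic_form E ((1 / norm x) *\<^sub>R x) ((1 / norm y) *\<^sub>R y)"
      using True fx by (simp add: biquadratic_form_scaleR)
    ultimately show ?thesis
      by (rule that)
  next
    case False
    then have "2 * \<beta>\<^sup>2 * (x \<bullet> x) = 2 * \<alpha>\<^sup>2 * (y \<bullet> y)"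
      using fx fy by simp
    with nrm have half: "2 * \<beta>\<^sup>2 * (x \<bullet> x) = 1 / 2" "2 * \<alpha>\<^sup>2 * (y \<bullet> y) = 1 / 2"
      by linarith+
    then have "((2 * \<beta>) *\<^sub>R x) \<bullet> ((2 * \<beta>) *\<^sub>R x) = 1" "((2 * \<alpha>) *\<^sub>R y) \<bullet> ((2 * \<alpha>) *\<^sub>R y) = 1"
      by (simp_all add: power2_eq_square)
    moreover have "biquadratic_form E x y = \<mu> / 2"
      unfolding fx half by simp
    \<comment> \<open>The rescaling multiplies the form by
      \<open>16 * \<alpha>\<^sup>2 * \<beta>\<^sup>2\<close>; applied to the value
      \<open>\<mu> / 2\<close> this produces the constant 8.\<close>
    then have "8 * \<alpha>\<^sup>2 * \<beta>\<^sup>2 * \<mu> = biquadratic_form E ((2 * \<beta>) *\<^sub>R x) ((2 * \<alpha>) *\<^sub>R y)"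
      by (simp add: biquadratic_form_scaleR power_mult_distrib)
    ultimately show ?thesis
      by (rule that)
  qed
qed

text \<open>A converse of \<open>recoverable_imp_value\<close>, valid for every M-eigenpair. The
  case \<open>c = 0\<close> is recoverable because both blocks of the constructed vector are
  nonzero.\<close>

lemma M_eigenpair_imp_recoverable:
  fixes E :: "real^'n^'m^'n^'m"
  assumes E: "partially_symmetric E" and pos: "\<alpha> > 0" "\<beta> > 0"
    and uv: "u \<bullet> u = 1" "v \<bullet> v = 1"
    and eu: "x_matrix E v *v u = c *\<^sub>R u"
    and ev: "y_matrix E u *v v = c *\<^sub>R v"
  shows "recoverable_B_eigenvalue \<alpha> \<beta> E (c / (8 * \<alpha>\<^sup>2 * \<beta>\<^sup>2))"
proof -
  \<comment> \<open>The factors \<open>1 / (2 * \<beta>)\<close> and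
    \<open>1 / (2 * \<alpha>)\<close> give each block the weighted square norm 1/2. In the first
    block equation the matrix then contributes \<open>1 / (4 * \<alpha>\<^sup>2)\<close> and the
    weight \<open>2 * \<beta>\<^sup>2\<close>, whence the divisor of \<open>c\<close>.\<close>
  define w :: "real^('m + 'n)" where
    "w = (\<chi> t. case t of Inl i \<Rightarrow> u $ i / (2 * \<beta>) | Inr j \<Rightarrow> v $ j / (2 * \<alpha>))"
  have x: "x_block w = (1 / (2 * \<beta>)) *\<^sub>R u" and y: "y_block w = (1 / (2 * \<alpha>)) *\<^sub>R v"
    by (simp_all add: w_def x_block_def y_block_def vec_eq_iff)
  have "u \<noteq> 0" "v \<noteq> 0"
    using uv by auto
  then have nz: "x_block w \<noteq> 0" "y_block w \<noteq> 0"
    using pos by (simp_all add: x y)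
  have "B_eigenpair (B_matrix \<alpha> \<beta>) (sym_lifted_tensor E) (c / (8 * \<alpha>\<^sup>2 * \<beta>\<^sup>2)) w"
    unfolding B_eigenpair_block_iff[OF E] x y x_matrix_scaleR y_matrix_scaleR
    using pos uv
    by (simp add: matrix_vector_mult_scaleR scaleR_matrix_vector_assoc[symmetric] eu ev
        field_simps power2_eq_square)
  with nz show ?thesis
    unfolding recoverable_B_eigenvalue_def by blast
qed

section \<open>The extreme recoverable eigenvalues\<close>

text \<open>Attainment comes from the eigenvector equations of a maximizing pair, the bound from the
  fact that every recoverable eigenvalue is a scaled value of the form on unit vectors.\<close>

lemma greatest_recoverable:
  fixes E :: "real^'n^'m^'n^'m"
  assumes E: "partially_symmetric E" and pos: "\<alpha> > 0" "\<beta> > 0"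
  shows "recoverable_B_eigenvalue \<alpha> \<beta> E (lambda_max_M E / (8 * \<alpha>\<^sup>2 * \<beta>\<^sup>2))"
    and "recoverable_B_eigenvalue \<alpha> \<beta> E \<mu> \<Longrightarrow> \<mu> \<le> lambda_max_M E / (8 * \<alpha>\<^sup>2 * \<beta>\<^sup>2)"
proof -
  obtain u v where uv: "u \<bullet> u = 1" "v \<bullet> v = 1" "lambda_max_M E = biquadratic_form E u v"
    and max: "\<And>x y. x \<bullet> x = 1 \<Longrightarrow> y \<bullet> y = 1 \<Longrightarrow> biquadratic_form E x y \<le> biquadratic_form E u v"
    using biquadratic_form_maximizer[of E] by blast
  show "recoverable_B_eigenvalue \<alpha> \<beta> E (lambda_max_M E / (8 * \<alpha>\<^sup>2 * \<beta>\<^sup>2))"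
    using M_eigenpair_imp_recoverable[OF E pos uv(1,2) maximizer_M_eigenpair[OF E uv(1,2) max]]
    unfolding uv(3) .
  show "\<mu> \<le> lambda_max_M E / (8 * \<alpha>\<^sup>2 * \<beta>\<^sup>2)" if rec: "recoverable_B_eigenvalue \<alpha> \<beta> E \<mu>"
  proof -
    obtain u v where "u \<bullet> u = 1" "v \<bullet> v = 1" "8 * \<alpha>\<^sup>2 * \<beta>\<^sup>2 * \<mu> = biquadratic_form E u v"
      using recoverable_imp_value[OF E rec] by blast
    then have "8 * \<alpha>\<^sup>2 * \<beta>\<^sup>2 * \<mu> \<le> lambda_max_M E"
      by (simp add: biquadratic_form_le_lambda_max_M)
    then show ?thesis
      using pos by (simp add: field_simps)
  qed
qed

text \<open>The same \<open>w\<close> serves both sides: negating \<open>E\<close> and the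
  eigenvalue together only changes the sign of both block equations. This reduces smallest
  eigenvalues to largest ones.\<close>

lemma recoverable_uminus:
  assumes "partially_symmetric E"
  shows "recoverable_B_eigenvalue \<alpha> \<beta> (- E) (- \<mu>) \<longleftrightarrow> recoverable_B_eigenvalue \<alpha> \<beta> E \<mu>"
  unfolding recoverable_B_eigenvalue_def B_eigenpair_block_iff[OF assms]
    B_eigenpair_block_iff[OF partially_symmetric_uminus[OF assms]]
  by (simp add: x_matrix_uminus y_matrix_uminus uminus_matrix_vector_mult)

lemma lambda_max_B_eq:
  assumes "partially_symmetric E" "\<alpha> > 0" "\<beta> > 0"
  shows "8 * \<alpha>\<^sup>2 * \<beta>\<^sup>2 * lambda_max_B \<alpha> \<beta> E = lambda_max_M E"
proof -
  have "lambda_max_B \<alpha> \<beta> E = lambda_max_M E / (8 * \<alpha>\<^sup>2 * \<beta>\<^sup>2)"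
    unfolding lambda_max_B_def using greatest_recoverable[OF assms] by (rule Greatest_equality)
  then show ?thesis
    using assms by simp
qed

lemma lambda_min_B_eq:
  assumes "partially_symmetric E" "\<alpha> > 0" "\<beta> > 0"
  shows "8 * \<alpha>\<^sup>2 * \<beta>\<^sup>2 * lambda_min_B \<alpha> \<beta> E = - lambda_max_M (- E)"
proof -
  note neg = greatest_recoverable[OF partially_symmetric_uminus[OF assms(1)] assms(2,3)]
  have "lambda_min_B \<alpha> \<beta> E = - (lambda_max_M (- E) / (8 * \<alpha>\<^sup>2 * \<beta>\<^sup>2))"
    unfolding lambda_min_B_def
  proof (rule Least_equality)
    show "recoverable_B_eigenvalue \<alpha> \<beta> E (- (lambda_max_M (- E) / (8 * \<alpha>\<^sup>2 * \<beta>\<^sup>2)))"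
      using neg(1) recoverable_uminus[OF assms(1), of \<alpha> \<beta>] by (metis minus_minus)
    show "- (lambda_max_M (- E) / (8 * \<alpha>\<^sup>2 * \<beta>\<^sup>2)) \<le> \<mu>"
      if "recoverable_B_eigenvalue \<alpha> \<beta> E \<mu>" for \<mu>
      using neg(2)[of "- \<mu>"] that recoverable_uminus[OF assms(1), of \<alpha> \<beta> \<mu>] by simp
  qed
  then show ?thesis
    using assms by simp
qed

section \<open>Perturbation bounds of Weyl type\<close>

text \<open>At a maximizing pair for \<open>A + E\<close> the form is the sum of two values, each at
  most the maximum of its own tensor.\<close>

lemma lambda_max_M_add_le: "lambda_max_M (A + E) \<le> lambda_max_M A + lambda_max_M E"
proof (rule biquadratic_form_maximizer[of "A + E"])
  fix u v
  assume uv: "u \<bullet> u = 1" "v \<bullet> v = 1" and max: "lambda_max_M (A + E) = biquadratic_form (A + E) u v"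
  show ?thesis
    unfolding max biquadratic_form_add
    using uv by (intro add_mono biquadratic_form_le_lambda_max_M)
qed

theorem corollary3p1:
  fixes A E :: "real^'n^'m^'n^'m" and \<alpha> \<beta> :: real
  assumes "partially_symmetric A" and "partially_symmetric E"
    and "\<alpha> > 0" and "\<beta> > 0"
  shows "lambda_max_M A + 8 * \<alpha>\<^sup>2 * \<beta>\<^sup>2 * lambda_min_B \<alpha> \<beta> E \<le> lambda_max_M (A + E) \<and>
         lambda_max_M (A + E) \<le> lambda_max_M A + 8 * \<alpha>\<^sup>2 * \<beta>\<^sup>2 * lambda_max_B \<alpha> \<beta> E"
  unfolding lambda_max_B_eq[OF assms(2-4)] lambda_min_B_eq[OF assms(2-4)]
  \<comment> \<open>The upper bound is subadditivity itself; the lower bound is subadditivity for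
    the splitting \<open>A = (A + E) + (- E)\<close>.\<close>
  using lambda_max_M_add_le[of A E] lambda_max_M_add_le[of "A + E" "- E"] by simp

end
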